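(* Consider the iteration $z_{n+1}=z_n^{\,x}+c$ with $z_0=e$ and $c=0$, and write $z_n(x)$ for the $n$-th iterate obtained with exponent $x\in\mathbb{C}$. Let $r=e$ and $x_0=1$. Then the following hold. (1) $x_0\in\partial E(e,0)$, and the orbit of $x_0$ is bounded. (2) For every $\delta>0$ there exists $x'\in\mathbb{R}$ with $1<x'<1+\delta$ such that $|z_1(x')|>r$ and $z_n(x')\to+\infty$ as $n\to\infty$. Consequently, for this particular threshold $r=e$, the extended-valued escape-time function $$T_r:\mathbb{C}\to[0,+\infty],\qquad T_r(x)=\inf\{n\in\mathbb{Z}_{\ge 0}: |z_n(x)|>r\},$$ where the infimum of the empty set is $+\infty$ and $[0,+\infty]$ carries its usual order topology, is discontinuous at $x_0=1$.
   Context: Complex powers: for $z\in\mathbb{C}\setminus\{0\}$ let $\log z=\ln|z|+i\operatorname{Arg}(z)$ with $\operatorname{Arg}(z)\in(-\pi,\pi]$ (so $\operatorname{Arg}(-a)=\pi$ for $a>0$), and for $x\in\mathbb{C}$ set $z^x=\exp(x\log z)$. For $z=0$: $0^x=0$ if $\operatorname{Re}(x)>0$, and $0^x$ is undefined if $\operatorname{Re}(x)\le 0$. For $(z_0,c,x)\in\mathbb{C}^3$, the orbit $\{z_n\}$ is generated by $z_{n+1}=z_n^{\,x}+c$, continuing as long as the next iterate is defined and terminating otherwise. Exponent Set: for fixed $z_0,c\in\mathbb{C}$, $E(z_0,c)$ is the set of all $x\in\mathbb{C}$ such that $z_n$ is defined for every $n\ge 0$ and $\sup_{n\ge0}|z_n|<\infty$.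 The symbol $\partial E(z_0,c)$ denotes its topological boundary in $\mathbb{C}$. Here $e=\exp(1)$. *)

theory Defs
  imports "HOL-Analysis.Analysis"
begin

text \<open>For \<open>z \<noteq> 0\<close> the library's complex \<open>powr\<close> is \<open>exp (x * Ln z)\<close> with \<open>Im (Ln z)\<close> in
  \<open>(-pi, pi]\<close>, and \<open>0 powr x = 0\<close> for every \<open>x\<close>. The only change needed is that
  \<open>0 ^ x\<close> is undefined (\<open>None\<close>) when \<open>Re x \<le> 0\<close>.\<close>

definition cpow :: "complex \<Rightarrow> complex \<Rightarrow> complex option" where
  "cpow z x = (if z = 0 \<and> Re x \<le> 0 then None else Some (z powr x))"

text \<open>\<open>orbit z0 c x n\<close> is \<open>Some\<close> of the \<open>n\<close>-th iterate, or \<open>None\<close> if the orbit has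
  terminated before step \<open>n\<close>.\<close>

fun orbit :: "complex \<Rightarrow> complex \<Rightarrow> complex \<Rightarrow> nat \<Rightarrow> complex option" where
  "orbit z0 c x 0 = Some z0"
| "orbit z0 c x (Suc n) =
     (case orbit z0 c x n of None \<Rightarrow> None | Some z \<Rightarrow> map_option (\<lambda>w. w + c) (cpow z x))"

definition bounded_orbit :: "complex \<Rightarrow> complex \<Rightarrow> complex \<Rightarrow> bool" where
  "bounded_orbit z0 c x \<longleftrightarrow>
     (\<forall>n. orbit z0 c x n \<noteq> None) \<and> bdd_above (range (\<lambda>n. cmod (the (orbit z0 c x n))))"

definition exponent_set :: "complex \<Rightarrow> complex \<Rightarrow> complex set" where
  "exponent_set z0 c = {x. bounded_orbit z0 c x}"

text \<open>The infimum is taken in \<open>ennreal\<close>, i.e. \<open>[0, \<infinity>]\<close> with its order topology, where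
  \<open>Inf {} = \<infinity>\<close>. Indices at which the iterate is undefined do not count as escaping.\<close>

definition escape_time :: "complex \<Rightarrow> complex \<Rightarrow> real \<Rightarrow> complex \<Rightarrow> ennreal" where
  "escape_time z0 c r x = (INF n \<in> {n. \<exists>z. orbit z0 c x n = Some z \<and> cmod z > r}. of_nat n)"

end

theory Submission imports Defs begin

text \<open>Taking logarithms turns \<open>z \<mapsto> z\<^sup>x\<close> into multiplication by \<open>x\<close>, as long as the logarithm stays
  in the strip of principal values. A real exponent keeps the orbit of \<open>e\<close> on the positive real
  axis, so \<open>z\<^sub>n = exp (x\<^sup>n)\<close> exactly (\<open>orbit_real_exponent\<close>), and everything is decided by
  the geometric sequence \<open>x\<^sup>n\<close>: it is constantly \<open>1\<close> for \<open>x = 1\<close> and diverges for every real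
  \<open>x > 1\<close>. Thus \<open>1\<close> belongs to the exponent set but is a limit, from the right along the real
  axis, of points outside it.

  For the escape time with threshold \<open>e\<close>, the orbit at \<open>x = 1\<close> sits exactly on the threshold and
  never exceeds it, whereas for real \<open>x > 1\<close> it starts on the threshold and exceeds it after
  one step. The escape time is therefore \<open>1\<close> at points arbitrarily close to one where it is
  \<open>\<infinity>\<close>.\<close>

lemma orbit_real_exponent:
  "orbit (exp 1) 0 (of_real x) n = Some (of_real (exp (x ^ n)))"
proof (induction n)
  case 0
  show ?case
    by (simp add: exp_of_real [symmetric])
next
  case (Suc n)
  have "complex_of_real (exp (x ^ n)) powr of_real x = of_real (exp (x ^ n) powr x)"
    by (rule powr_of_real) simp
  also have "exp (x ^ n) powr x = exp (x ^ Suc n)"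
    by (simp add: powr_def)
  finally show ?case
    using Suc.IH by (simp add: cpow_def)
qed

lemma filterlim_exp_power_at_top:
  fixes x :: real
  assumes "1 < x"
  shows "filterlim (\<lambda>n. exp (x ^ n)) at_top sequentially"
proof (rule filterlim_compose [OF exp_at_top])
  have "filterlim (\<lambda>n. x ^ n) at_infinity sequentially"
    using assms by (intro filterlim_realpow_sequentially_gt1) auto
  then show "filterlim (\<lambda>n. x ^ n) at_top sequentially"
    using assms by (intro filterlim_at_infinity_imp_filterlim_at_top) auto
qed

lemma bounded_orbit_one: "bounded_orbit (exp 1) 0 1"
  using orbit_real_exponent [of 1] by (simp add: bounded_orbit_def)

lemma not_bounded_orbit_real_gt_1:
  assumes "1 < x"
  shows "\<not> bounded_orbit (exp 1) 0 (of_real x)"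
proof
  assume "bounded_orbit (exp 1) 0 (of_real x)"
  then obtain B where B: "\<And>n. exp (x ^ n) \<le> B"
    by (auto simp: bounded_orbit_def orbit_real_exponent bdd_above_def)
  have "eventually (\<lambda>n. B < exp (x ^ n)) sequentially"
    using filterlim_exp_power_at_top [OF assms] by (simp add: filterlim_at_top_dense)
  then show False
    using B by (force simp: eventually_sequentially not_less [symmetric])
qed

lemma escape_time_one: "escape_time (exp 1) 0 (exp 1) 1 = \<infinity>"
  using orbit_real_exponent [of 1] by (simp add: escape_time_def)

lemma escape_time_real_gt_1:
  assumes "1 < x"
  shows "escape_time (exp 1) 0 (exp 1) (of_real x) = 1"
proof -
  have "{n. \<exists>z. orbit (exp 1) 0 (of_real x) n = Some z \<and> cmod z > exp 1} = {1..}"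
    using assms by (auto simp: orbit_real_exponent Suc_le_eq one_less_power intro!: gr0I)
  moreover have "(INF n\<in>{1::nat..}. of_nat n) = (1::ennreal)"
  proof (rule antisym)
    show "(INF n\<in>{1::nat..}. of_nat n) \<le> (1::ennreal)"
      by (rule INF_lower2 [of 1]) auto
    show "(1::ennreal) \<le> (INF n\<in>{1::nat..}. of_nat n)"
    proof (rule INF_greatest)
      fix n :: nat
      assume "n \<in> {1..}"
      then show "(1::ennreal) \<le> of_nat n"
        using of_nat_mono [of 1 n, where 'a = ennreal] by simp
    qed
  qed
  ultimately show ?thesis
    by (simp add: escape_time_def)
qed

lemma LIMSEQ_one_plus_inverse: "(\<lambda>n. complex_of_real (1 + inverse (real (Suc n)))) \<longlonglongrightarrow> 1"
  using tendsto_of_real [OF LIMSEQ_inverse_real_of_nat_add [of 1], where 'a = complex] by simp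

lemma one_in_frontier_exponent_set: "1 \<in> frontier (exponent_set (exp 1) 0)"
proof -
  have "1 \<in> closure (exponent_set (exp 1) 0)"
    using bounded_orbit_one by (intro subsetD [OF closure_subset]) (simp add: exponent_set_def)
  moreover have "1 \<in> closure (- exponent_set (exp 1) 0)"
    unfolding closure_sequential
    using LIMSEQ_one_plus_inverse not_bounded_orbit_real_gt_1
    by (intro exI [of _ "\<lambda>n. complex_of_real (1 + inverse (real (Suc n)))"])
       (auto simp: exponent_set_def simp del: of_real_add of_real_inverse)
  ultimately show ?thesis
    by (simp add: frontier_closures)
qed

lemma not_isCont_escape_time: "\<not> isCont (escape_time (exp 1) 0 (exp 1)) 1"
proof
  assume "isCont (escape_time (exp 1) 0 (exp 1)) 1"
  then have "(\<lambda>n. escape_time (exp 1) 0 (exp 1) (complex_of_real (1 + inverse (real (Suc n))))) \<longlonglongrightarrow> \<infinity>"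
    using isCont_tendsto_compose [OF _ LIMSEQ_one_plus_inverse] escape_time_one by metis
  moreover have "escape_time (exp 1) 0 (exp 1) (complex_of_real (1 + inverse (real (Suc n)))) = 1" for n
    by (rule escape_time_real_gt_1) simp
  ultimately have "(\<lambda>n::nat. 1::ennreal) \<longlonglongrightarrow> \<infinity>"
    by (simp only:)
  then show False
    using LIMSEQ_unique [OF tendsto_const] by fastforce
qed

theorem theorem3p6:
  fixes r :: real and x0 :: complex
  assumes "r = exp 1" and "x0 = 1"
  shows "(x0 \<in> frontier (exponent_set (exp 1) 0) \<and> bounded_orbit (exp 1) 0 x0) \<and>
    (\<forall>\<delta>>0. \<exists>x'::real. 1 < x' \<and> x' < 1 + \<delta> \<and>
       (\<exists>s :: nat \<Rightarrow> real.
          (\<forall>n. orbit (exp 1) 0 (of_real x') n = Some (of_real (s n))) \<and>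
          cmod (of_real (s 1)) > r \<and>
          filterlim s at_top sequentially)) \<and>
    \<not> isCont (escape_time (exp 1) 0 r) x0"
proof -
  have "\<exists>x'::real. 1 < x' \<and> x' < 1 + \<delta> \<and>
       (\<exists>s :: nat \<Rightarrow> real.
          (\<forall>n. orbit (exp 1) 0 (of_real x') n = Some (of_real (s n))) \<and>
          cmod (of_real (s 1)) > r \<and>
          filterlim s at_top sequentially)" if "\<delta> > 0" for \<delta> :: real
  proof -
    have "1 < 1 + \<delta>"
      using that by simp
    then obtain x' where x': "1 < x'" "x' < 1 + \<delta>"
      using dense by blast
    have "cmod (of_real (exp (x' ^ 1))) > r"
      using x'(1) assms(1) by simp
    with x' show ?thesis
      using orbit_real_exponent [of x'] filterlim_exp_power_at_top [OF x'(1)]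
      by (intro exI [of _ x'] conjI exI [of _ "\<lambda>n. exp (x' ^ n)"]) auto
  qed
  then show ?thesis
    using one_in_frontier_exponent_set bounded_orbit_one not_isCont_escape_time assms by blast
qed

end
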